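(* Let $\mathcal{M}$ be a finite dimensional von Neumann algebra, and let $\mathcal{N}$ be a von Neumann subalgebra of $\mathcal{M}$. Let $\rho$ be a faithful state on $\mathcal{M}$, and let $\Delta_\rho$ be the modular operator on $\mathcal{M}$ defined by $\Delta_\rho(X) = \rho X \rho^{-1}$. Let $\mathcal{P}_\rho$ be the orthogonal projection from $\mathcal{M}$ onto $\mathcal{N}$ in the GNS inner product induced by $\rho$. Then: (1) $\mathcal{P}_\rho$ is real, i.e., it preserves self-adjointness, if and only if $\mathcal{N}$ is invariant under $\Delta_\rho$. (2) $\mathcal{N}$ is invariant under $\Delta_\rho$ if and only if for all $A \in \mathcal{N}$, $$\Delta_\rho(A) = \Delta_{\rho_{\mathcal{N}}}(A),$$ in which case $\Delta^t_\rho(A) = \Delta^t_{\rho_{\mathcal{N}}}(A)$ for all $t\in \mathbb{R}$ (and all $A\in\mathcal{N}$). Furthermore, $\Delta_\rho(A) = \Delta_{\rho_{\mathcal{N}}}(A)$ is valid for all $A\in \mathcal{N}$ if and only if $\mathcal{A}_\rho(A) = A$ for all $A\in \mathcal{N}$.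
   Context: $\mathcal{M}$ is regarded as a unital $*$-subalgebra of $M_n(\mathbb{C})$; $\mathrm{Tr}$ is the trace on $M_n(\mathbb{C})$, $\mathbf{1}$ the identity. A von Neumann subalgebra is a $*$-subalgebra containing $\mathbf{1}$. States on $\mathcal{M}$ are identified with density matrices $\rho\in\mathcal{M}$ ($\rho\ge0$, $\mathrm{Tr}[\rho]=1$) via $\rho(X)=\mathrm{Tr}[\rho X]$; faithful means $\rho$ invertible. The GNS inner product induced by $\rho$ is $\langle X,Y\rangle_{GNS,\rho}=\rho(X^*Y)=\mathrm{Tr}[\rho X^*Y]$. $\mathcal{E}_\tau:\mathcal{M}\to\mathcal{N}$ is the orthogonal projection of $\mathcal{M}$ onto $\mathcal{N}$ for the inner product $\mathrm{Tr}[X^*Y]$, $\rho_{\mathcal{N}}=\mathcal{E}_\tau(\rho)$, and $\Delta_{\rho_{\mathcal{N}}}(X)=\rho_{\mathcal{N}}X\rho_{\mathcal{N}}^{-1}$. Powers are $\Delta_\rho^t(X)=\rho^tX\rho^{-t}$ and similarly for $\rho_{\mathcal{N}}$. "$\mathcal{N}$ is invariant under $\Delta_\rho$" means $\Delta_\rho(A)\in\mathcal{N}$ for all $A\in\mathcal{N}$. The Accardi-Cecchini coarse graining operator $\mathcal{A}_\rho:\mathcal{M}\to\mathcal{N}$ is $\mathcal{A}_\rho(X)=\rho_{\mathcal{N}}^{-1/2}\mathcal{E}_\tau(\rho^{1/2}X\rho^{1/2})\rho_{\mathcal{N}}^{-1/2}$. *)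

theory Defs
  imports "HOL-Analysis.Analysis"
begin

type_synonym 'n cmat = "complex ^ 'n ^ 'n"

definition adj :: "'n::finite cmat \<Rightarrow> 'n cmat" where
  "adj A = map_matrix cnj (transpose A)"

definition self_adjoint :: "'n::finite cmat \<Rightarrow> bool" where
  "self_adjoint A \<longleftrightarrow> adj A = A"

definition unitary :: "'n::finite cmat \<Rightarrow> bool" where
  "unitary U \<longleftrightarrow> adj U ** U = mat 1 \<and> U ** adj U = mat 1"

definition positive_semidefinite :: "'n::finite cmat \<Rightarrow> bool" where
  "positive_semidefinite A \<longleftrightarrow>
     self_adjoint A \<and> (\<forall>v. 0 \<le> Re (\<Sum>i\<in>UNIV. cnj (v $ i) * (A *v v) $ i))"

(* Unital *-subalgebras of M_n(C): these are the (concretely represented)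
   finite-dimensional von Neumann algebras. *)
definition von_neumann_algebra :: "('n::finite cmat) set \<Rightarrow> bool" where
  "von_neumann_algebra M \<longleftrightarrow>
     mat 1 \<in> M \<and>
     (\<forall>A\<in>M. \<forall>B\<in>M. A + B \<in> M) \<and>
     (\<forall>c. \<forall>A\<in>M. map_matrix ((*) c) A \<in> M) \<and>
     (\<forall>A\<in>M. \<forall>B\<in>M. A ** B \<in> M) \<and>
     (\<forall>A\<in>M. adj A \<in> M)"

definition von_neumann_subalgebra :: "('n::finite cmat) set \<Rightarrow> 'n cmat set \<Rightarrow> bool" where
  "von_neumann_subalgebra N M \<longleftrightarrow> von_neumann_algebra N \<and> N \<subseteq> M"

(* The density matrix of the state X \<mapsto> trace (\<rho> ** X) on M. *)
definition state :: "('n::finite cmat) set \<Rightarrow> 'n cmat \<Rightarrow> bool" where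
  "state M \<rho> \<longleftrightarrow> \<rho> \<in> M \<and> positive_semidefinite \<rho> \<and> trace \<rho> = 1"

definition faithful_state :: "('n::finite cmat) set \<Rightarrow> 'n cmat \<Rightarrow> bool" where
  "faithful_state M \<rho> \<longleftrightarrow> state M \<rho> \<and> invertible \<rho>"

definition diag_mat :: "('n \<Rightarrow> real) \<Rightarrow> 'n::finite cmat" where
  "diag_mat d = (\<chi> i j. if i = j then complex_of_real (d i) else 0)"

(* Real powers by functional calculus: diagonalise A by a unitary and raise the
   eigenvalues to the power t.  The result does not depend on the chosen
   diagonalisation.  Only meant for positive definite A. *)
definition mat_powr :: "'n::finite cmat \<Rightarrow> real \<Rightarrow> 'n cmat" where
  "mat_powr A t = (THE B. \<exists>U d. unitary U \<and> A = U ** diag_mat d ** adj U \<and>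
                          B = U ** diag_mat (\<lambda>i. d i powr t) ** adj U)"

definition hs_inner :: "'n::finite cmat \<Rightarrow> 'n cmat \<Rightarrow> complex" where
  "hs_inner X Y = trace (adj X ** Y)"

definition gns_inner :: "'n::finite cmat \<Rightarrow> 'n cmat \<Rightarrow> 'n cmat \<Rightarrow> complex" where
  "gns_inner \<rho> X Y = trace (\<rho> ** adj X ** Y)"

(* The orthogonal projection onto the subspace N for the inner product ip:
   the unique element of N whose difference from X is orthogonal to N.  The
   ambient algebra M of a projection M -> N only restricts the arguments X. *)
definition orth_proj ::
    "('n::finite cmat \<Rightarrow> 'n cmat \<Rightarrow> complex) \<Rightarrow> 'n cmat set \<Rightarrow> 'n cmat \<Rightarrow> 'n cmat" where
  "orth_proj ip N X = (THE Y. Y \<in> N \<and> (\<forall>Z\<in>N. ip Z (X - Y) = 0))"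

definition gns_proj :: "'n::finite cmat \<Rightarrow> 'n cmat set \<Rightarrow> 'n cmat \<Rightarrow> 'n cmat" where
  "gns_proj \<rho> N = orth_proj (gns_inner \<rho>) N"

definition tracial_proj :: "('n::finite cmat) set \<Rightarrow> 'n cmat \<Rightarrow> 'n cmat" where
  "tracial_proj N = orth_proj hs_inner N"

definition modular :: "'n::finite cmat \<Rightarrow> 'n cmat \<Rightarrow> 'n cmat" where
  "modular \<rho> X = \<rho> ** X ** matrix_inv \<rho>"

definition modular_powr :: "'n::finite cmat \<Rightarrow> real \<Rightarrow> 'n cmat \<Rightarrow> 'n cmat" where
  "modular_powr \<rho> t X = mat_powr \<rho> t ** X ** mat_powr \<rho> (- t)"

definition invariant_under :: "('n::finite cmat) set \<Rightarrow> ('n cmat \<Rightarrow> 'n cmat) \<Rightarrow> bool" where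
  "invariant_under N T \<longleftrightarrow> (\<forall>A\<in>N. T A \<in> N)"

definition real_map_on :: "('n::finite cmat) set \<Rightarrow> ('n cmat \<Rightarrow> 'n cmat) \<Rightarrow> bool" where
  "real_map_on M P \<longleftrightarrow> (\<forall>X\<in>M. self_adjoint X \<longrightarrow> self_adjoint (P X))"

definition accardi_cecchini :: "'n::finite cmat \<Rightarrow> 'n cmat set \<Rightarrow> 'n cmat \<Rightarrow> 'n cmat" where
  "accardi_cecchini \<rho> N X =
     (let \<rho>N = tracial_proj N \<rho> in
        mat_powr \<rho>N (- 1/2) **
        tracial_proj N (mat_powr \<rho> (1/2) ** X ** mat_powr \<rho> (1/2)) **
        mat_powr \<rho>N (- 1/2))"

end

theory Submission
  imports Defs "HOL-Computational_Algebra.Polynomial"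
begin

text \<open>Write \<open>\<sigma>\<close> for the tracial projection \<open>E \<rho>\<close> of \<open>\<rho>\<close>. As \<open>E\<close> is a bimodule map, the GNS projection is
  \<open>X \<mapsto> E (X \<rho>) \<sigma>\<inverse>\<close>; testing the reality of this map against the trace turns it into the relation
  \<open>\<rho> A \<sigma> = \<sigma> A \<rho>\<close> for all \<open>A\<close> in \<open>N\<close>, which is equality of the two modular operators on \<open>N\<close>. If \<open>N\<close> is
  invariant, then applying \<open>E\<close> to \<open>\<Delta> A \<rho> = \<rho> A\<close> gives \<open>\<Delta> A \<sigma> = \<sigma> A\<close>. Real powers of a modular
  operator are polynomials in it, so equality passes to all powers.

  If the Accardi-Cecchini operator fixes \<open>N\<close>, put \<open>w = \<rho>\<^sup>1\<^sup>/\<^sup>2 \<sigma>\<^sup>-\<^sup>1\<^sup>/\<^sup>2\<close>. Then \<open>D \<mapsto> w D\<close> and \<open>D \<mapsto> D w\<^sup>*\<close> are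
  isometries on \<open>N\<close> for the Hilbert-Schmidt norm with \<open>\<langle>D w\<^sup>*, w D\<rangle> = \<langle>D, D\<rangle>\<close>, hence they agree. So
  \<open>w\<close> is Hermitian and commutes with \<open>N\<close>, and \<open>\<rho>\<^sup>1\<^sup>/\<^sup>2 = w \<sigma>\<^sup>1\<^sup>/\<^sup>2\<close> induces the same modular operator as \<open>\<sigma>\<close>.\<close>

section \<open>Matrix algebra\<close>

lemma adj_component: "adj A $ i $ j = cnj (A $ j $ i)"
  by (simp add: adj_def map_matrix_def transpose_def)

lemma adj_mult: "adj (A ** B) = adj B ** adj A"
  by (simp add: vec_eq_iff adj_component matrix_matrix_mult_def mult.commute)

lemma adj_adj [simp]: "adj (adj A) = A"
  by (simp add: vec_eq_iff adj_component)

lemma adj_diff: "adj (A - B) = adj A - adj B"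
  by (simp add: vec_eq_iff adj_component)

lemma adj_add: "adj (A + B) = adj A + adj B"
  by (simp add: vec_eq_iff adj_component)

lemma adj_diag_mat [simp]: "adj (diag_mat d) = diag_mat d"
  by (simp add: vec_eq_iff adj_component diag_mat_def)

abbreviation cscale :: "complex \<Rightarrow> 'n::finite cmat \<Rightarrow> 'n cmat" where
  "cscale c \<equiv> map_matrix ((*) c)"

lemma adj_cscale: "adj (cscale c A) = cscale (cnj c) (adj A)"
  by (simp add: vec_eq_iff adj_component map_matrix_def)

lemma cscale_mult_left: "cscale c A ** B = cscale c (A ** B)"
  by (simp add: vec_eq_iff matrix_matrix_mult_def map_matrix_def sum_distrib_left mult.assoc)

lemma cscale_mult_right: "A ** cscale c B = cscale c (A ** B)"
  by (simp add: vec_eq_iff matrix_matrix_mult_def map_matrix_def sum_distrib_left algebra_simps)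

lemma trace_cscale: "trace (cscale c A) = c * trace A"
  by (simp add: trace_def map_matrix_def sum_distrib_left)

lemma trace_adj: "trace (adj A) = cnj (trace A)"
  by (simp add: trace_def adj_component)

lemma matrix_diff_ldistrib: "(A::'n::finite cmat) ** (B - C) = A ** B - A ** C"
  by (simp add: vec_eq_iff matrix_matrix_mult_def sum_subtractf algebra_simps)

lemma matrix_diff_rdistrib: "((B::'n::finite cmat) - C) ** A = B ** A - C ** A"
  by (simp add: vec_eq_iff matrix_matrix_mult_def sum_subtractf algebra_simps)

lemma matrix_add_rdistrib: "((B::'n::finite cmat) + C) ** A = B ** A + C ** A"
  by (simp add: vec_eq_iff matrix_matrix_mult_def sum.distrib algebra_simps)

lemma matrix_mult_0_right: "(A :: 'n::finite cmat) ** 0 = 0"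
  by (simp add: vec_eq_iff matrix_matrix_mult_def)

lemma cscale_1: "cscale 1 A = A"
  by (simp add: vec_eq_iff)

text \<open>\<open>matrix_mul_assoc\<close> brackets products to the left, where an inner inverse
  pair only shows up in the form \<open>A ** B ** C\<close>; this lets the simplifier cancel it
  there.\<close>

lemma matrix_mult_cancel:
  fixes B C :: "'n::finite cmat"
  assumes "B ** C = mat 1"
  shows "A ** B ** C = A"
  using assms by (simp flip: matrix_mul_assoc)

text \<open>Links the Euclidean structure of the matrix type to the Hilbert-Schmidt product, so that
  definiteness and orthogonal decomposition can be taken from it.\<close>

lemma inner_cmat: "inner X Y = Re (trace (adj X ** Y))"
  for X Y :: "'n::finite cmat"
proof -
  have "inner X Y = (\<Sum>i\<in>UNIV. \<Sum>j\<in>UNIV. Re (cnj (X$i$j) * Y$i$j))"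
    by (simp add: inner_vec_def inner_complex_def)
  also have "\<dots> = (\<Sum>j\<in>UNIV. \<Sum>i\<in>UNIV. Re (cnj (X$i$j) * Y$i$j))"
    by (rule sum.swap)
  finally show ?thesis
    by (simp add: trace_def matrix_matrix_mult_def adj_component)
qed

lemma trace_adj_mult_eq_0: "trace (adj X ** X) = 0 \<Longrightarrow> X = 0"
  using inner_cmat[of X X] by simp

section \<open>Diagonalization of Hermitian matrices\<close>

text \<open>Rayleigh quotient: at a maximizer \<open>v\<close> on the unit sphere of
  \<open>W\<close>, the form of \<open>g = c - f\<close> is nonnegative on \<open>W\<close> and
  vanishes at \<open>v\<close>, which forces \<open>g v = 0\<close>.\<close>

lemma symmetric_linear_eigenvector:
  fixes f :: "'a::euclidean_space \<Rightarrow> 'a"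
  assumes lin: "linear f" and sym: "\<And>x y. inner (f x) y = inner x (f y)"
    and W: "subspace W" "\<And>x. x \<in> W \<Longrightarrow> f x \<in> W" and ne: "u \<in> W" "u \<noteq> 0"
  obtains v c where "v \<in> W" "norm v = 1" "f v = c *\<^sub>R v"
proof -
  let ?S = "sphere 0 1 \<inter> W"
  have "compact ?S"
    by (simp add: compact_Int_closed closed_subspace W)
  moreover have "(1 / norm u) *\<^sub>R u \<in> ?S"
    using ne W by (simp add: subspace_scale)
  moreover have "continuous_on ?S (\<lambda>x. inner x (f x))"
    using lin by (intro continuous_intros linear_continuous_on) (simp add: linear_conv_bounded_linear)
  ultimately obtain v where v: "v \<in> ?S" and max: "\<And>x. x \<in> ?S \<Longrightarrow> inner x (f x) \<le> inner v (f v)"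
    using continuous_attains_sup[of ?S "\<lambda>x. inner x (f x)"] by blast
  define c where "c = inner v (f v)"
  define g where "g x = c *\<^sub>R x - f x" for x
  have psd: "inner x (g x) \<ge> 0" if "x \<in> W" for x
  proof (cases "x = 0")
    case True
    then show ?thesis by simp
  next
    case False
    let ?y = "(1 / norm x) *\<^sub>R x"
    have "?y \<in> ?S" using False that W by (simp add: subspace_scale)
    then have "inner ?y (f ?y) \<le> c" using max c_def by blast
    then have "inner x (f x) / (norm x)\<^sup>2 \<le> c"
      by (simp add: linear_scale[OF lin] power2_eq_square)
    then have "inner x (f x) \<le> c * (norm x)\<^sup>2"
      using False by (simp add: divide_le_eq)
    then show ?thesis
      by (simp add: g_def inner_diff_right power2_norm_eq_inner)
  qed
  have glin: "g (x + t *\<^sub>R y) = g x + t *\<^sub>R g y" for x y t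
    by (simp add: g_def linear_add[OF lin] linear_scale[OF lin] algebra_simps)
  have gsym: "inner (g x) y = inner x (g y)" for x y
    by (simp add: g_def inner_diff sym)
  have gv0: "inner v (g v) = 0"
    using v by (simp add: g_def inner_diff_right c_def norm_eq_1)
  have gW: "g v \<in> W"
    unfolding g_def using v W by (simp add: subspace_diff subspace_scale)
  let ?a = "inner (g v) (g v)" and ?b = "inner (g v) (g (g v))"
  \<comment> \<open>Nonnegativity of the form along the line through \<open>v\<close> in direction
    \<open>g v\<close>; the constant term is \<open>inner v (g v) = 0\<close>.\<close>
  have quad: "0 \<le> 2 * t * ?a + t\<^sup>2 * ?b" for t
  proof -
    have "v + t *\<^sub>R g v \<in> W" using v gW W by (simp add: subspace_add subspace_scale)
    moreover have "inner v (g (g v)) = ?a"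
      by (simp only: gsym[of v "g v"])
    ultimately show ?thesis
      using psd[of "v + t *\<^sub>R g v"]
      by (simp add: glin inner_add_left inner_add_right gv0 power2_eq_square distrib_left mult.assoc)
  qed
  have "?a = 0"
  proof (rule ccontr)
    assume "?a \<noteq> 0"
    then have a: "?a > 0" by simp
    have b: "?b \<ge> 0" using psd gW by simp
    \<comment> \<open>A negative \<open>t\<close> small enough for the linear term to dominate; the
      \<open>+ 1\<close> keeps the denominator positive when \<open>?b\<close> is zero.\<close>
    have "2 * (- ?a / (?b + 1)) * ?a + (- ?a / (?b + 1))\<^sup>2 * ?b
        = - (?a\<^sup>2 * (?b + 2) / (?b + 1)\<^sup>2)"
      using b by (simp add: divide_simps power2_eq_square) (simp add: algebra_simps)
    moreover have "?a\<^sup>2 * (?b + 2) / (?b + 1)\<^sup>2 > 0"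
      using a b by simp
    ultimately show False using quad[of "- ?a / (?b + 1)"] by linarith
  qed
  then have "f v = c *\<^sub>R v" by (simp add: g_def)
  then show ?thesis using that[of v c] v by simp
qed

text \<open>The conditions are rows of a square matrix whose row \<open>k\<close> is zero. Such a
  matrix has no right inverse, hence no left inverse, hence a nontrivial kernel.\<close>

lemma exists_nonzero_orthogonal:
  fixes b :: "'n::finite \<Rightarrow> complex ^ 'n"
  assumes "k \<notin> I"
  obtains u where "u \<noteq> 0" "\<And>i. i \<in> I \<Longrightarrow> (\<Sum>l\<in>UNIV. cnj (b i $ l) * u $ l) = 0"
proof -
  define B :: "'n cmat" where "B = (\<chi> i l. if i \<in> I then cnj (b i $ l) else 0)"
  have "\<not> (\<exists>C. C ** B = mat 1)"
  proof
    assume "\<exists>C. C ** B = mat 1"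
    then obtain C where "B ** C = mat 1" using matrix_left_right_inverse by blast
    then have "(B ** C) $ k $ k = 1" by (simp add: mat_def)
    then show False using assms by (simp add: matrix_matrix_mult_def B_def)
  qed
  then obtain u where u: "B *v u = 0" "u \<noteq> 0"
    using matrix_left_invertible_ker by blast
  have "(\<Sum>l\<in>UNIV. cnj (b i $ l) * u $ l) = 0" if "i \<in> I" for i
  proof -
    have "(B *v u) $ i = 0" using u(1) by simp
    then show ?thesis using that by (simp add: matrix_vector_mult_def B_def)
  qed
  then show ?thesis using that u(2) by blast
qed

lemma self_adjoint_cinner:
  assumes "self_adjoint A"
  shows "(\<Sum>i\<in>UNIV. cnj (x $ i) * (A *v y) $ i) = (\<Sum>i\<in>UNIV. cnj ((A *v x) $ i) * y $ i)"
proof -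
  have A: "cnj (A $ j $ i) = A $ i $ j" for i j
    using assms by (metis adj_component self_adjoint_def)
  have "(\<Sum>i\<in>UNIV. cnj (x $ i) * (A *v y) $ i) = (\<Sum>i\<in>UNIV. \<Sum>j\<in>UNIV. cnj (x $ i) * (A $ i $ j * y $ j))"
    by (simp add: matrix_vector_mult_def sum_distrib_left)
  also have "\<dots> = (\<Sum>j\<in>UNIV. \<Sum>i\<in>UNIV. cnj (x $ i) * (A $ i $ j * y $ j))"
    by (rule sum.swap)
  also have "\<dots> = (\<Sum>j\<in>UNIV. cnj ((A *v x) $ j) * y $ j)"
    by (simp add: matrix_vector_mult_def sum_distrib_left sum_distrib_right A mult.assoc)
      (simp add: mult_ac)
  finally show ?thesis .
qed

text \<open>Induction on the index set: the orthogonal complement of the eigenvectors found so far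
  is nonzero and invariant under \<open>A\<close>, so it contains a further one.\<close>

lemma self_adjoint_orthonormal_eigenvectors:
  fixes A :: "'n::finite cmat" and I :: "'n set"
  assumes A: "self_adjoint A"
  shows "\<exists>b d. \<forall>i\<in>I. A *v b i = d i *\<^sub>R b i \<and>
           (\<forall>j\<in>I. (\<Sum>l\<in>UNIV. cnj (b i $ l) * b j $ l) = (if i = j then 1 else 0))"
  using finite[of I]
proof induction
  case empty
  then show ?case by simp
next
  case (insert k I)
  then obtain b d where eig: "\<And>i. i \<in> I \<Longrightarrow> A *v b i = d i *\<^sub>R b i"
    and orth: "\<And>i j. i \<in> I \<Longrightarrow> j \<in> I \<Longrightarrow> (\<Sum>l\<in>UNIV. cnj (b i $ l) * b j $ l) = (if i = j then 1 else 0)"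
    by metis
  obtain u where u: "u \<noteq> 0" "\<And>i. i \<in> I \<Longrightarrow> (\<Sum>l\<in>UNIV. cnj (b i $ l) * u $ l) = 0"
    using exists_nonzero_orthogonal insert.hyps(2) by blast
  \<comment> \<open>The complement for the complex pairing: the eigenvector is found in
    \<open>W\<close> by a real argument, yet is orthogonal to the earlier ones in the complex
    sense.\<close>
  define W where "W = {v. \<forall>i\<in>I. (\<Sum>l\<in>UNIV. cnj (b i $ l) * v $ l) = 0}"
  have lin: "linear ((*v) A)"
    by (rule linearI) (simp_all add: vec_eq_iff matrix_vector_mult_def sum.distrib algebra_simps
        scaleR_sum_right)
  have re: "inner x y = Re (\<Sum>i\<in>UNIV. cnj (x $ i) * y $ i)" for x y :: "complex ^ 'n"
    by (simp add: inner_vec_def inner_complex_def)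
  have sym: "inner (A *v x) y = inner x (A *v y)" for x y
    unfolding re by (simp only: self_adjoint_cinner[OF A])
  have W: "subspace W"
    by (auto simp: subspace_def W_def sum.distrib algebra_simps simp flip: scaleR_sum_right)
  have inv: "A *v x \<in> W" if "x \<in> W" for x
    using that unfolding W_def
    by (auto simp: self_adjoint_cinner[OF A] eig simp flip: scaleR_sum_right)
  obtain v c where v: "v \<in> W" "norm v = 1" "A *v v = c *\<^sub>R v"
    using symmetric_linear_eigenvector[OF lin sym W inv, of u] u unfolding W_def by blast
  have vb: "(\<Sum>l\<in>UNIV. cnj (b i $ l) * v $ l) = 0" if "i \<in> I" for i
    using v that by (simp add: W_def)
  have bv: "(\<Sum>l\<in>UNIV. cnj (v $ l) * b i $ l) = 0" if "i \<in> I" for i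
  proof -
    have "(\<Sum>l\<in>UNIV. cnj (v $ l) * b i $ l) = cnj (\<Sum>l\<in>UNIV. cnj (b i $ l) * v $ l)"
      by (simp add: mult.commute)
    then show ?thesis using vb[OF that] by simp
  qed
  have vv: "(\<Sum>l\<in>UNIV. cnj (v $ l) * v $ l) = 1"
  proof -
    have "cnj z * z = of_real (inner z z)" for z :: complex
      by (simp add: complex_eq_iff inner_complex_def)
    then have "(\<Sum>l\<in>UNIV. cnj (v $ l) * v $ l) = of_real (inner v v)"
      by (simp add: inner_vec_def)
    then show ?thesis using v by (simp add: norm_eq_1)
  qed
  show ?case
    using insert.hyps(2)
    by (intro exI[of _ "b(k := v)"] exI[of _ "d(k := c)"]) (auto simp: eig orth vb bv vv v(3))
qed

theorem self_adjoint_diagonalization: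
  fixes A :: "'n::finite cmat"
  assumes "self_adjoint A"
  obtains U d where "unitary U" "A = U ** diag_mat d ** adj U"
proof -
  obtain b :: "'n \<Rightarrow> complex ^ 'n" and d where eig: "\<And>i. A *v b i = d i *\<^sub>R b i"
    and orth: "\<And>i j. (\<Sum>l\<in>UNIV. cnj (b i $ l) * b j $ l) = (if i = j then 1 else 0)"
    using self_adjoint_orthonormal_eigenvectors[OF assms, of UNIV] by (metis UNIV_I)
  define U :: "'n cmat" where "U = (\<chi> i j. b j $ i)"
  have 1: "adj U ** U = mat 1"
    by (simp add: vec_eq_iff matrix_matrix_mult_def adj_component U_def orth mat_def)
  then have 2: "U ** adj U = mat 1"
    using matrix_left_right_inverse by blast
  have "(A ** U) $ i $ j = (U ** diag_mat d) $ i $ j" for i j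
  proof -
    have "(A *v b j) $ i = d j *\<^sub>R (b j $ i)" by (simp add: eig)
    then show ?thesis
      by (simp add: matrix_matrix_mult_def matrix_vector_mult_def U_def diag_mat_def if_distrib
          scaleR_conv_of_real mult.commute cong: if_cong)
  qed
  then have "A ** U = U ** diag_mat d" by (simp add: vec_eq_iff)
  then have "A = U ** diag_mat d ** adj U"
    by (metis 2 matrix_mul_assoc matrix_mul_rid)
  then show ?thesis using that 1 2 by (simp add: unitary_def)
qed

section \<open>Functional calculus\<close>

lemma poly_interpolation:
  fixes f :: "'a::field \<Rightarrow> 'a"
  assumes "finite S"
  shows "\<exists>p. \<forall>x\<in>S. poly p x = f x"
  using assms
proof induction
  case empty
  then show ?case by simp
next
  case (insert a S)
  then obtain p where p: "\<And>x. x \<in> S \<Longrightarrow> poly p x = f x" by blast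
  \<comment> \<open>Newton interpolation: a multiple of \<open>?q\<close> corrects the value at
    \<open>a\<close> without changing those on \<open>S\<close>.\<close>
  let ?q = "\<Prod>x\<in>S. [:- x, 1:]"
  have q: "poly ?q a \<noteq> 0" "\<And>x. x \<in> S \<Longrightarrow> poly ?q x = 0"
    using insert.hyps by (auto simp: poly_prod)
  have "\<forall>x\<in>insert a S. poly (p + smult ((f a - poly p a) / poly ?q a) ?q) x = f x"
    using p q by simp
  then show ?case by blast
qed

definition unitary_diag :: "'n::finite cmat \<Rightarrow> ('n \<Rightarrow> real) \<Rightarrow> 'n cmat" where
  "unitary_diag U d = U ** diag_mat d ** adj U"

lemma diag_mat_mult_component:
  "(diag_mat d ** A ** diag_mat e) $ i $ j = of_real (d i * e j) * A $ i $ j"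
  by (simp add: matrix_matrix_mult_def diag_mat_def if_distrib if_distribR cong: if_cong)

lemma diag_mat_mult: "(diag_mat d :: 'a::finite cmat) ** diag_mat e = diag_mat (\<lambda>i. d i * e i)"
proof -
  have "(\<Sum>k\<in>UNIV. (if i = k then a k else 0) * (if k = j then b k else 0)) =
      (if i = j then a i * b i else 0)" for i j and a b :: "'a \<Rightarrow> complex"
    by (subst sum.remove[of _ i]) (auto intro!: sum.neutral)
  then show ?thesis
    by (simp add: vec_eq_iff matrix_matrix_mult_def diag_mat_def)
qed

lemma unitary_conj:
  assumes "unitary U"
  shows "adj U ** (U ** A ** adj U) ** U = A" "U ** (adj U ** A ** U) ** adj U = A"
proof -
  have U: "adj U ** U = mat 1" "U ** adj U = mat 1"
    using assms by (auto simp: unitary_def)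
  show "adj U ** (U ** A ** adj U) ** U = A"
    by (metis U(1) matrix_mul_assoc matrix_mul_lid matrix_mul_rid)
  show "U ** (adj U ** A ** U) ** adj U = A"
    by (metis U(2) matrix_mul_assoc matrix_mul_lid matrix_mul_rid)
qed

lemma unitary_diag_mult:
  assumes "unitary U"
  shows "unitary_diag U d ** unitary_diag U e = unitary_diag U (\<lambda>i. d i * e i)"
proof -
  have "unitary_diag U d ** unitary_diag U e = U ** diag_mat d ** (adj U ** U) ** diag_mat e ** adj U"
    by (simp add: unitary_diag_def matrix_mul_assoc)
  also have "\<dots> = unitary_diag U (\<lambda>i. d i * e i)"
    using assms by (simp add: unitary_def unitary_diag_def flip: diag_mat_mult matrix_mul_assoc)
  finally show ?thesis .
qed

lemma adj_unitary_diag [simp]: "adj (unitary_diag U d) = unitary_diag U d"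
  by (simp add: unitary_diag_def adj_mult matrix_mul_assoc)

lemma unitary_diag_add: "unitary_diag (U :: 'a::finite cmat) (\<lambda>i. d i + e i) = unitary_diag U d + unitary_diag U e"
proof -
  have "(diag_mat (\<lambda>i. d i + e i) :: 'a cmat) = diag_mat d + diag_mat e"
    by (simp add: vec_eq_iff diag_mat_def)
  then show ?thesis by (simp add: unitary_diag_def matrix_add_ldistrib matrix_add_rdistrib)
qed

lemma unitary_diag_const:
  assumes "unitary U"
  shows "unitary_diag (U :: 'a::finite cmat) (\<lambda>i. c) = cscale (of_real c) (mat 1)"
proof -
  have "(diag_mat (\<lambda>i. c) :: 'a cmat) = cscale (of_real c) (mat 1)"
    by (simp add: vec_eq_iff diag_mat_def mat_def)
  then show ?thesis
    using assms by (simp add: unitary_diag_def unitary_def cscale_mult_left cscale_mult_right)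
qed

lemma unitary_diag_eq_0:
  assumes "unitary U" "unitary_diag U d = 0"
  shows "d i = 0"
proof -
  have "diag_mat d = adj U ** 0 ** U"
    using unitary_conj(1)[OF assms(1), of "diag_mat d"] assms(2) by (simp add: unitary_diag_def)
  also have "\<dots> = 0"
    by (simp add: vec_eq_iff matrix_matrix_mult_def)
  finally have "diag_mat d $ i $ i = 0" by simp
  then show ?thesis by (simp add: diag_mat_def)
qed

text \<open>The Horner step behind the inductions over polynomials.\<close>

lemma unitary_diag_poly_pCons:
  assumes "unitary U"
  shows "unitary_diag U (\<lambda>i. poly (pCons c p) (d i)) =
    cscale (of_real c) (mat 1) + unitary_diag U d ** unitary_diag U (\<lambda>i. poly p (d i))"
  unfolding poly_pCons unitary_diag_add by (simp only: unitary_diag_const[OF assms] unitary_diag_mult[OF assms])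

lemma unitary_diag_poly_cong:
  assumes "unitary U" "unitary V" "unitary_diag U d = unitary_diag V e"
  shows "unitary_diag U (\<lambda>i. poly p (d i)) = unitary_diag V (\<lambda>i. poly p (e i))"
proof (induction p)
  case 0
  then show ?case by (simp add: unitary_diag_const assms)
next
  case (pCons c p)
  then show ?case by (simp only: unitary_diag_poly_pCons assms)
qed

text \<open>A function of a Hermitian matrix is a polynomial in it, by interpolation on the spectrum.
  Hence the functional calculus does not depend on the diagonalization and stays in every unital
  algebra that contains the matrix.\<close>

lemma unitary_diag_fun_cong:
  assumes "unitary U" "unitary V" "unitary_diag U d = unitary_diag V e"
  shows "unitary_diag U (\<lambda>i. f (d i)) = unitary_diag V (\<lambda>i. f (e i))"
proof -
  obtain p where "\<forall>x\<in>range d \<union> range e. poly p x = f x"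
    using poly_interpolation[of "range d \<union> range e" f] by auto
  then show ?thesis using unitary_diag_poly_cong[OF assms, of p] by simp
qed

text \<open>Independence of the diagonalization gives the uniqueness that the definite description
  in \<open>mat_powr\<close> requires.\<close>

lemma mat_powr_unitary_diag:
  assumes "unitary U"
  shows "mat_powr (unitary_diag U d) t = unitary_diag U (\<lambda>i. d i powr t)"
  unfolding mat_powr_def unitary_diag_def[symmetric]
proof (rule the_equality)
  show "\<exists>V e. unitary V \<and> unitary_diag U d = unitary_diag V e \<and>
      unitary_diag U (\<lambda>i. d i powr t) = unitary_diag V (\<lambda>i. e i powr t)"
    using assms by blast
  fix B assume "\<exists>V e. unitary V \<and> unitary_diag U d = unitary_diag V e \<and> B = unitary_diag V (\<lambda>i. e i powr t)"
  then show "B = unitary_diag U (\<lambda>i. d i powr t)"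
    using unitary_diag_fun_cong[OF assms, where f = "\<lambda>x. x powr t"] by metis
qed

lemma vna_0:
  assumes "von_neumann_algebra N"
  shows "0 \<in> N"
proof -
  have "cscale 0 (mat 1) \<in> N"
    using assms unfolding von_neumann_algebra_def by blast
  moreover have "cscale 0 (mat 1) = 0"
    by (simp add: vec_eq_iff)
  ultimately show ?thesis by metis
qed

lemma unitary_diag_fun_in_vna:
  assumes N: "von_neumann_algebra N" and U: "unitary U" "unitary_diag U d \<in> N"
  shows "unitary_diag U (\<lambda>i. f (d i)) \<in> N"
proof -
  have poly: "unitary_diag U (\<lambda>i. poly p (d i)) \<in> N" for p
  proof (induction p)
    case 0
    have "unitary_diag U (\<lambda>i. 0) = 0"
      by (simp add: unitary_diag_const U vec_eq_iff)
    then show ?case using vna_0[OF N] by simp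
  next
    case (pCons c p)
    then show ?case
      using N U unfolding von_neumann_algebra_def by (simp only: unitary_diag_poly_pCons)
  qed
  obtain p where "\<forall>x\<in>range d. poly p x = f x"
    using poly_interpolation[of "range d" f] by auto
  then show ?thesis using poly[of p] by simp
qed

text \<open>Stated in spectral form, so that unfolding it yields the diagonalization on which
  \<open>mat_powr\<close> is computed.\<close>

definition posdef :: "'n::finite cmat \<Rightarrow> bool" where
  "posdef R \<longleftrightarrow> (\<exists>U d. unitary U \<and> R = unitary_diag U d \<and> (\<forall>i. d i > 0))"

lemma mat_powr_add:
  "posdef R \<Longrightarrow> mat_powr R s ** mat_powr R t = mat_powr R (s + t)"
  by (auto simp: posdef_def mat_powr_unitary_diag unitary_diag_mult powr_add)

text \<open>Strict positivity matters here, because \<open>0 powr 0\<close> is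
  \<open>0\<close>.\<close>

lemma mat_powr_0: "posdef R \<Longrightarrow> mat_powr R 0 = mat 1"
  by (auto simp: posdef_def mat_powr_unitary_diag unitary_diag_const cscale_1 less_imp_neq[symmetric])

lemma mat_powr_1: "posdef R \<Longrightarrow> mat_powr R 1 = R"
  by (auto simp: posdef_def mat_powr_unitary_diag less_imp_le)

lemma adj_mat_powr: "posdef R \<Longrightarrow> adj (mat_powr R t) = mat_powr R t"
  by (auto simp: posdef_def mat_powr_unitary_diag)

lemma mat_powr_in_vna:
  "von_neumann_algebra N \<Longrightarrow> posdef R \<Longrightarrow> R \<in> N \<Longrightarrow> mat_powr R t \<in> N"
  by (auto simp: posdef_def mat_powr_unitary_diag unitary_diag_fun_in_vna[where f = "\<lambda>x. x powr t"])

lemma mat_powr_cancel: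
  assumes "posdef R"
  shows "mat_powr R t ** mat_powr R (- t) = mat 1" "mat_powr R (- t) ** mat_powr R t = mat 1"
  using assms by (simp_all add: mat_powr_add mat_powr_0)

lemma matrix_inv_unique:
  fixes A B :: "'n::finite cmat"
  assumes "A ** B = mat 1" "B ** A = mat 1"
  shows "matrix_inv A = B"
proof -
  have "A ** matrix_inv A = mat 1 \<and> matrix_inv A ** A = mat 1"
    unfolding matrix_inv_def by (rule someI[of _ B]) (use assms in blast)
  then show ?thesis by (metis assms(2) matrix_mul_assoc matrix_mul_lid matrix_mul_rid)
qed

lemma modular_eq_modular_powr: "posdef R \<Longrightarrow> modular R A = modular_powr R 1 A"
  using matrix_inv_unique[of R "mat_powr R (- 1)"] mat_powr_cancel[of R 1]
  by (simp add: modular_def modular_powr_def mat_powr_1)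

text \<open>An eigenvalue is the value of the quadratic form at a column of \<open>U\<close>, hence
  nonnegative; invertibility excludes zero.\<close>

lemma posdef_faithful_state:
  assumes "positive_semidefinite R" "invertible R"
  shows "posdef R"
proof -
  have "self_adjoint R" using assms by (simp add: positive_semidefinite_def)
  then obtain U d where U: "unitary U" and R: "R = unitary_diag U d"
    using self_adjoint_diagonalization unfolding unitary_diag_def by metis
  have "d i > 0" for i
  proof -
    have "of_real (d i) = (adj U ** R ** U) $ i $ i"
      using unitary_conj(1)[OF U, of "diag_mat d"] by (simp add: R unitary_diag_def diag_mat_def)
    also have "\<dots> = (adj U ** (R ** U)) $ i $ i"
      by (simp only: matrix_mul_assoc)
    also have "\<dots> = (\<Sum>k\<in>UNIV. cnj (column i U $ k) * (R *v column i U) $ k)"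
      by (simp add: matrix_matrix_mult_def matrix_vector_mult_def adj_component column_def)
    finally have "d i = Re (\<Sum>k\<in>UNIV. cnj (column i U $ k) * (R *v column i U) $ k)"
      by (metis Re_complex_of_real)
    then have "d i \<ge> 0"
      using assms(1) by (simp add: positive_semidefinite_def)
    moreover have "d i \<noteq> 0"
    proof
      assume "d i = 0"
      \<comment> \<open>The projection onto the \<open>i\<close>-th eigenvector, which
        \<open>R\<close> would annihilate.\<close>
      define W where "W = unitary_diag U (\<lambda>j. if j = i then 1 else 0)"
      have "(\<lambda>j. d j * (if j = i then 1 else 0)) = (\<lambda>j. 0)"
        using \<open>d i = 0\<close> by auto
      then have RW: "R ** W = 0"
        by (simp add: W_def R unitary_diag_mult U unitary_diag_const vec_eq_iff)
      obtain R' where "R' ** R = mat 1"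
        using assms(2) by (auto simp: invertible_def)
      then have "W = R' ** (R ** W)"
        by (simp add: matrix_mul_assoc)
      also have "\<dots> = 0"
        by (simp only: RW matrix_mult_0_right)
      finally show False using unitary_diag_eq_0[OF U, of _ i] by (fastforce simp: W_def)
    qed
    ultimately show ?thesis by simp
  qed
  then show ?thesis using U R unfolding posdef_def by blast
qed

section \<open>Powers of modular operators\<close>

text \<open>A Schur multiplier in the basis given by \<open>U\<close>: the matrix units conjugated
  by \<open>U\<close> are its eigenvectors, with eigenvalues \<open>g i j\<close>. Modular powers
  are of this form.\<close>

definition schur_conj :: "'n::finite cmat \<Rightarrow> ('n \<Rightarrow> 'n \<Rightarrow> real) \<Rightarrow> 'n cmat \<Rightarrow> 'n cmat" where
  "schur_conj U g A = U ** (\<chi> i j. of_real (g i j) * (adj U ** A ** U) $ i $ j) ** adj U"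

lemma unitary_diag_mult_unitary_diag:
  assumes "unitary U"
  shows "unitary_diag U d ** A ** unitary_diag U e = schur_conj U (\<lambda>i j. d i * e j) A"
proof -
  have "unitary_diag U d ** A ** unitary_diag U e = U ** (diag_mat d ** (adj U ** A ** U) ** diag_mat e) ** adj U"
    by (simp add: unitary_diag_def matrix_mul_assoc)
  also have "diag_mat d ** (adj U ** A ** U) ** diag_mat e =
      (\<chi> i j. of_real (d i * e j) * (adj U ** A ** U) $ i $ j)"
    by (simp only: vec_eq_iff diag_mat_mult_component vec_lambda_beta) simp
  finally show ?thesis by (simp add: schur_conj_def)
qed

lemma schur_conj_add: "schur_conj U (\<lambda>i j. g i j + h i j) A = schur_conj U g A + schur_conj U h A"
proof -
  have "(\<chi> i j. of_real (g i j + h i j) * (adj U ** A ** U) $ i $ j) =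
     (\<chi> i j. of_real (g i j) * (adj U ** A ** U) $ i $ j) +
     (\<chi> i j. of_real (h i j) * (adj U ** A ** U) $ i $ j)"
    by (simp add: vec_eq_iff distrib_right)
  then show ?thesis by (simp add: schur_conj_def matrix_add_ldistrib matrix_add_rdistrib)
qed

lemma schur_conj_const:
  assumes "unitary U"
  shows "schur_conj U (\<lambda>i j. c) A = cscale (of_real c) A"
proof -
  have "(\<chi> i j. of_real c * (adj U ** A ** U) $ i $ j) = cscale (of_real c) (adj U ** A ** U)"
    by (simp add: vec_eq_iff)
  then show ?thesis
    by (simp only: schur_conj_def cscale_mult_left cscale_mult_right unitary_conj[OF assms])
qed

lemma schur_conj_schur_conj:
  assumes "unitary U"
  shows "schur_conj U g (schur_conj U h A) = schur_conj U (\<lambda>i j. h i j * g i j) A"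
  unfolding schur_conj_def unitary_conj[OF assms] by (simp add: mult_ac)

lemma modular_powr_unitary_diag:
  assumes "unitary U" "\<And>i. d i > 0"
  shows "modular_powr (unitary_diag U d) t A = schur_conj U (\<lambda>i j. (d i / d j) powr t) A"
  using assms by (simp add: modular_powr_def mat_powr_unitary_diag unitary_diag_mult_unitary_diag
      powr_divide powr_minus_divide less_imp_le)

text \<open>Here the interpolation argument is applied to the modular operators themselves: their
  powers are polynomials in them.\<close>

lemma modular_powr_cong:
  assumes R: "posdef R" and S: "posdef S"
    and eq: "\<And>A. A \<in> N \<Longrightarrow> modular R A = modular S A"
    and inv: "\<And>A. A \<in> N \<Longrightarrow> modular S A \<in> N" and A: "A \<in> N"
  shows "modular_powr R t A = modular_powr S t A"
proof -
  obtain U d where U: "unitary U" "R = unitary_diag U d" "\<And>i. d i > 0"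
    using R unfolding posdef_def by blast
  obtain V e where V: "unitary V" "S = unitary_diag V e" "\<And>i. e i > 0"
    using S unfolding posdef_def by blast
  have mR: "modular R B = schur_conj U (\<lambda>i j. d i / d j) B" for B
    by (simp add: modular_eq_modular_powr R) (simp add: modular_powr_unitary_diag U less_imp_le)
  have mS: "modular S B = schur_conj V (\<lambda>i j. e i / e j) B" for B
    by (simp add: modular_eq_modular_powr S) (simp add: modular_powr_unitary_diag V less_imp_le)
  have poly: "schur_conj U (\<lambda>i j. poly p (d i / d j)) B = schur_conj V (\<lambda>i j. poly p (e i / e j)) B"
    if "B \<in> N" for p B
    using that
  proof (induction p arbitrary: B)
    case 0
    then show ?case by (simp add: schur_conj_const U V)
  next
    case (pCons c p)
    have *: "schur_conj U (\<lambda>i j. d i / d j * poly p (d i / d j)) B =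
        schur_conj U (\<lambda>i j. poly p (d i / d j)) (modular R B)"
      "schur_conj V (\<lambda>i j. e i / e j * poly p (e i / e j)) B =
        schur_conj V (\<lambda>i j. poly p (e i / e j)) (modular S B)"
      by (simp_all only: mR mS schur_conj_schur_conj U(1) V(1))
    \<comment> \<open>The induction hypothesis is used at \<open>modular S B\<close>, which is why
      \<open>B\<close> is arbitrary and \<open>N\<close> has to be invariant.\<close>
    have "schur_conj U (\<lambda>i j. d i / d j * poly p (d i / d j)) B =
        schur_conj V (\<lambda>i j. e i / e j * poly p (e i / e j)) B"
      unfolding * eq[OF pCons.prems] using pCons.IH inv[OF pCons.prems] by blast
    then show ?case
      by (simp only: poly_pCons schur_conj_add schur_conj_const U V)
  qed
  \<comment> \<open>The spectra of both modular operators, so that one polynomial serves for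
    both.\<close>
  let ?X = "range (\<lambda>(i, j). d i / d j) \<union> range (\<lambda>(i, j). e i / e j)"
  have "finite ?X" by simp
  then obtain p where "\<forall>x\<in>?X. poly p x = x powr t"
    using poly_interpolation[of ?X "\<lambda>x. x powr t"] by blast
  moreover have "d i / d j \<in> ?X" "e i / e j \<in> ?X" for i j
    using range_eqI[of _ "\<lambda>(i, j). d i / d j" "(i, j)"] range_eqI[of _ "\<lambda>(i, j). e i / e j" "(i, j)"]
    by simp_all
  ultimately have p: "poly p (d i / d j) = (d i / d j) powr t"
    "poly p (e i / e j) = (e i / e j) powr t" for i j
    by blast+
  show ?thesis
    using poly[OF A, of p] unfolding p U(2) V(2) by (simp add: modular_powr_unitary_diag U V)
qed

section \<open>The tracial projection\<close>

context
  fixes N :: "'n::finite cmat set"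
  assumes N: "von_neumann_algebra N"
begin

lemma vna_closed:
  shows "mat 1 \<in> N" "A \<in> N \<Longrightarrow> B \<in> N \<Longrightarrow> A + B \<in> N" "A \<in> N \<Longrightarrow> cscale c A \<in> N"
    "A \<in> N \<Longrightarrow> B \<in> N \<Longrightarrow> A ** B \<in> N" "A \<in> N \<Longrightarrow> adj A \<in> N"
  using N by (simp_all add: von_neumann_algebra_def)

lemma vna_diff: "A \<in> N \<Longrightarrow> B \<in> N \<Longrightarrow> A - B \<in> N"
proof -
  assume "A \<in> N" "B \<in> N"
  then have "A + cscale (-1) B \<in> N" using vna_closed by blast
  moreover have "A + cscale (-1) B = A - B" by (simp add: vec_eq_iff)
  ultimately show ?thesis by metis
qed

lemma trace_eq_0_imp:
  assumes "D \<in> N" "\<And>Z. Z \<in> N \<Longrightarrow> trace (Z ** D) = 0"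
  shows "D = 0"
  using assms vna_closed(5) trace_adj_mult_eq_0 by blast

text \<open>Orthogonal decomposition along \<open>N\<close> as a real subspace kills the real part
  of the trace.\<close>

lemma tracial_decomposition: "\<exists>Y\<in>N. \<forall>Z\<in>N. trace (Z ** (X - Y)) = 0"
proof -
  have "c *\<^sub>R A = cscale (of_real c) A" for c :: real and A :: "'n cmat"
    by (simp add: vec_eq_iff) (simp add: scaleR_conv_of_real)
  then have sub: "subspace N"
    unfolding subspace_def by (simp add: vna_closed vna_0[OF N])
  obtain Y W where Y: "Y \<in> span N" and W: "\<And>Z. Z \<in> span N \<Longrightarrow> orthogonal W Z" and X: "X = Y + W"
    using orthogonal_subspace_decomp_exists[of N X] by metis
  have re: "Re (trace (Z ** W)) = 0" if "Z \<in> N" for Z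
  proof -
    have "inner (adj Z) W = 0"
      using W[of "adj Z"] that by (simp add: span_base vna_closed orthogonal_def inner_commute)
    then show ?thesis by (simp add: inner_cmat)
  qed
  \<comment> \<open>Testing with \<open>\<i>\<close> times \<open>Z\<close>, again in
    \<open>N\<close>, takes care of the imaginary part.\<close>
  have "trace (Z ** W) = 0" if "Z \<in> N" for Z
    using re[OF that] re[OF vna_closed(3)[OF that, of \<i>]]
    by (simp add: complex_eq_iff cscale_mult_left trace_cscale)
  moreover have "Y \<in> N" using Y sub by (metis span_eq_iff)
  ultimately show ?thesis using X by (intro bexI[of _ Y]) auto
qed

text \<open>The way in which projections are identified below. Closure of \<open>N\<close> under
  \<open>adj\<close> removes the adjoint from the test elements.\<close>

lemma tracial_proj_unique:
  assumes "Y \<in> N" "\<And>Z. Z \<in> N \<Longrightarrow> trace (Z ** Y) = trace (Z ** X)"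
  shows "tracial_proj N X = Y"
  unfolding tracial_proj_def orth_proj_def hs_inner_def
proof (rule the_equality)
  show "Y \<in> N \<and> (\<forall>Z\<in>N. trace (adj Z ** (X - Y)) = 0)"
    using assms by (simp add: vna_closed matrix_diff_ldistrib trace_sub)
  fix Y' assume Y': "Y' \<in> N \<and> (\<forall>Z\<in>N. trace (adj Z ** (X - Y')) = 0)"
  have "trace (Z ** (Y' - Y)) = 0" if "Z \<in> N" for Z
    using Y' assms(2)[OF that] vna_closed(5)[OF that]
    by (force simp: matrix_diff_ldistrib trace_sub)
  then show "Y' = Y"
    using trace_eq_0_imp[of "Y' - Y"] vna_diff Y' assms(1) by simp
qed

lemma tracial_proj_props:
  "tracial_proj N X \<in> N \<and> (\<forall>Z\<in>N. trace (Z ** tracial_proj N X) = trace (Z ** X))"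
proof -
  obtain Y where "Y \<in> N" "\<And>Z. Z \<in> N \<Longrightarrow> trace (Z ** Y) = trace (Z ** X)"
    using tracial_decomposition[of X] by (auto simp: matrix_diff_ldistrib trace_sub)
  then show ?thesis using tracial_proj_unique by metis
qed

lemma tracial_proj_in: "tracial_proj N X \<in> N"
  and trace_tracial_proj: "Z \<in> N \<Longrightarrow> trace (Z ** tracial_proj N X) = trace (Z ** X)"
  using tracial_proj_props by auto

lemma tracial_proj_mult_left: "A \<in> N \<Longrightarrow> tracial_proj N (A ** X) = A ** tracial_proj N X"
  by (rule tracial_proj_unique)
    (simp_all add: tracial_proj_in vna_closed trace_tracial_proj matrix_mul_assoc)

text \<open>Cyclicity of the trace moves \<open>A\<close> to the test element, where it is absorbed
  into \<open>N\<close>.\<close>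

lemma tracial_proj_mult_right:
  assumes "A \<in> N" shows "tracial_proj N (X ** A) = tracial_proj N X ** A"
proof (rule tracial_proj_unique)
  fix Z assume "Z \<in> N"
  have "trace (Z ** (tracial_proj N X ** A)) = trace (A ** Z ** tracial_proj N X)"
    by (metis matrix_mul_assoc trace_mul_sym)
  also have "\<dots> = trace (A ** Z ** X)"
    by (simp add: trace_tracial_proj vna_closed assms \<open>Z \<in> N\<close>)
  also have "\<dots> = trace (Z ** (X ** A))"
    by (metis matrix_mul_assoc trace_mul_sym)
  finally show "trace (Z ** (tracial_proj N X ** A)) = trace (Z ** (X ** A))" .
qed (simp add: tracial_proj_in vna_closed assms)

lemma tracial_proj_adj: "tracial_proj N (adj X) = adj (tracial_proj N X)"
proof (rule tracial_proj_unique)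
  fix Z assume "Z \<in> N"
  then have "trace (adj Z ** tracial_proj N X) = trace (adj Z ** X)"
    by (simp add: trace_tracial_proj vna_closed)
  then have "trace (adj (adj Z ** tracial_proj N X)) = trace (adj (adj Z ** X))"
    by (simp add: trace_adj)
  then show "trace (Z ** adj (tracial_proj N X)) = trace (Z ** adj X)"
    unfolding adj_mult adj_adj by (metis trace_mul_sym)
qed (simp add: tracial_proj_in vna_closed)

text \<open>The spectral projection \<open>P\<close> of the projected matrix for its nonpositive
  eigenvalues lies in \<open>N\<close>. So the sum of these eigenvalues is
  \<open>trace (P ** R)\<close>, a squared norm; it must vanish, and then so does
  \<open>P\<close>.\<close>

lemma posdef_tracial_proj:
  assumes R: "posdef R"
  shows "posdef (tracial_proj N R)"
proof -
  let ?S = "tracial_proj N R"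
  have "self_adjoint ?S"
    using tracial_proj_adj[of R] adj_mat_powr[OF R, of 1]
    by (simp add: self_adjoint_def mat_powr_1 R)
  then obtain V s where V: "unitary V" and S: "?S = unitary_diag V s"
    using self_adjoint_diagonalization unfolding unitary_diag_def by metis
  have "s k > 0" for k
  proof (rule ccontr)
    assume k: "\<not> s k > 0"
    define P where "P = unitary_diag V (\<lambda>i. if s i > 0 then 0 else 1)"
    have PN: "P \<in> N"
      unfolding P_def using unitary_diag_fun_in_vna[OF N V, of s "\<lambda>x. if x > 0 then 0 else 1"]
        tracial_proj_in[of R] S by simp
    have PP: "P ** P = P"
      unfolding P_def by (simp add: unitary_diag_mult V if_distrib cong: if_cong)
    have trace_unitary_diag: "trace (unitary_diag V d) = of_real (\<Sum>i\<in>UNIV. d i)" for d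
    proof -
      have "trace (unitary_diag V d) = trace (adj V ** V ** diag_mat d)"
        by (metis unitary_diag_def matrix_mul_assoc trace_mul_sym)
      then show ?thesis
        using V by (simp add: unitary_def trace_def diag_mat_def)
    qed
    let ?r = "mat_powr R (1/2)"
    have r: "?r ** ?r = R" "adj ?r = ?r"
      by (simp_all add: mat_powr_add R mat_powr_1 adj_mat_powr)
    have "adj (?r ** P) ** (?r ** P) = P ** R ** P"
      by (simp add: adj_mult r(2) matrix_mul_assoc) (simp add: P_def r(1) flip: matrix_mul_assoc)
    then have "trace (adj (?r ** P) ** (?r ** P)) = trace (P ** R ** P)" by simp
    also have "\<dots> = trace (P ** R)"
      by (metis PP matrix_mul_assoc trace_mul_sym)
    also have "\<dots> = trace (P ** ?S)"
      by (simp add: trace_tracial_proj PN)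
    also have "\<dots> = of_real (\<Sum>i\<in>UNIV. if s i > 0 then 0 else s i)"
      by (simp add: S P_def unitary_diag_mult V trace_unitary_diag if_distrib if_distribR cong: if_cong)
    finally have "inner (?r ** P) (?r ** P) = (\<Sum>i\<in>UNIV. if s i > 0 then 0 else s i)"
      by (simp add: inner_cmat)
    also have "\<dots> \<le> 0"
      by (intro sum_nonpos) auto
    finally have "?r ** P = 0"
      by (metis inner_ge_zero inner_eq_zero_iff order_antisym)
    then have "mat_powr R (- (1/2)) ** (?r ** P) = 0"
      by (simp only: matrix_mult_0_right)
    then have "P = 0"
      using mat_powr_cancel(2)[OF R, of "1/2"] by (simp add: matrix_mul_assoc)
    then show False
      using unitary_diag_eq_0[OF V, of _ k] k unfolding P_def by fastforce
  qed
  then show ?thesis unfolding posdef_def using V S by blast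
qed

end

section \<open>Modular operators and projections\<close>

locale vna_posdef =
  fixes N :: "'n::finite cmat set" and R :: "'n cmat"
  assumes N: "von_neumann_algebra N" and R: "posdef R"
begin

abbreviation S where "S \<equiv> tracial_proj N R"
abbreviation Ri where "Ri \<equiv> mat_powr R (- 1)"
abbreviation Si where "Si \<equiv> mat_powr S (- 1)"

lemma S: "posdef S"
  by (rule posdef_tracial_proj[OF N R])

lemmas closed = vna_closed[OF N] tracial_proj_in[OF N]

lemma powr_S_in: "mat_powr S t \<in> N"
  by (simp add: mat_powr_in_vna N S closed)

lemma adj_R_S: "adj R = R" "adj S = S"
  using adj_mat_powr[OF R, of 1] adj_mat_powr[OF S, of 1] by (simp_all add: mat_powr_1 R S)

lemma inverse_R_S: "R ** Ri = mat 1" "Ri ** R = mat 1" "S ** Si = mat 1" "Si ** S = mat 1"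
  using mat_powr_cancel[OF R, of 1] mat_powr_cancel[OF S, of 1] by (simp_all add: mat_powr_1 R S)

lemmas cancel_R_S = inverse_R_S inverse_R_S[THEN matrix_mult_cancel]

lemma modular_R: "modular R A = R ** A ** Ri"
  and modular_S: "modular S A = S ** A ** Si"
  using matrix_inv_unique[OF inverse_R_S(1,2)] matrix_inv_unique[OF inverse_R_S(3,4)]
  by (simp_all add: modular_def)

text \<open>An inverse-free form, obtained by replacing \<open>A\<close> by \<open>A ** S\<close> or
  \<open>A ** Si\<close>, which stay in \<open>N\<close>.\<close>

lemma modular_eq_iff:
  "(\<forall>A\<in>N. modular R A = modular S A) \<longleftrightarrow> (\<forall>A\<in>N. R ** A ** S = S ** A ** R)"
proof
  assume L: "\<forall>A\<in>N. modular R A = modular S A"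
  show "\<forall>A\<in>N. R ** A ** S = S ** A ** R"
  proof
    fix A assume "A \<in> N"
    then have "modular R (A ** S) = modular S (A ** S)"
      using L by (simp add: closed)
    then have "R ** A ** S ** Ri ** R = S ** A ** S ** Si ** R"
      by (simp add: modular_R modular_S matrix_mul_assoc)
    then show "R ** A ** S = S ** A ** R"
      by (simp add: cancel_R_S)
  qed
next
  assume L: "\<forall>A\<in>N. R ** A ** S = S ** A ** R"
  show "\<forall>A\<in>N. modular R A = modular S A"
  proof
    fix A assume "A \<in> N"
    then have "R ** (A ** Si) ** S = S ** (A ** Si) ** R"
      using L by (simp add: closed powr_S_in)
    then have "R ** A ** Si ** S ** Ri = S ** A ** Si ** R ** Ri"
      by (simp add: matrix_mul_assoc)
    then show "modular R A = modular S A"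
      by (simp add: modular_R modular_S cancel_R_S)
  qed
qed

lemma modular_S_in: "A \<in> N \<Longrightarrow> modular S A \<in> N"
  by (simp add: modular_S closed powr_S_in)

lemma invariant_iff:
  "invariant_under N (modular R) \<longleftrightarrow> (\<forall>A\<in>N. modular R A = modular S A)"
proof
  assume inv: "invariant_under N (modular R)"
  show "\<forall>A\<in>N. modular R A = modular S A"
  proof
    fix A assume A: "A \<in> N"
    let ?B = "modular R A"
    have B: "?B \<in> N" using inv A by (simp add: invariant_under_def)
    have "?B ** R = R ** A"
      by (simp add: modular_R cancel_R_S)
    \<comment> \<open>Both sides are projected; \<open>?B\<close> and \<open>A\<close> come out of
      the projection because both lie in \<open>N\<close>.\<close>
    then have "?B ** S = S ** A"
      using tracial_proj_mult_left[OF N B, of R] tracial_proj_mult_right[OF N A, of R] by simp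
    then have "modular S A = ?B ** S ** Si"
      by (simp add: modular_S)
    then show "?B = modular S A"
      by (simp add: cancel_R_S)
  qed
qed (simp add: invariant_under_def modular_S_in)

section \<open>The GNS projection and its reality\<close>

lemma trace_cyclic3: "trace ((A :: 'n cmat) ** B ** C) = trace (C ** A ** B)"
  using trace_mul_sym[of "A ** B" C] by (simp add: matrix_mul_assoc)

lemma trace_mult_S: "A \<in> N \<Longrightarrow> trace (A ** S) = trace (A ** R)"
  by (rule trace_tracial_proj[OF N])

lemma gns_inner_alt: "gns_inner R Z (X - Y) = trace (adj Z ** X ** R) - trace (adj Z ** Y ** R)"
proof -
  have "gns_inner R Z W = trace (adj Z ** W ** R)" for W
    unfolding gns_inner_def trace_cyclic3[of "adj Z"] ..
  then show ?thesis
    by (simp add: matrix_diff_ldistrib matrix_diff_rdistrib trace_sub)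
qed

text \<open>For \<open>Y\<close> in \<open>N\<close>, the trace of \<open>adj Z ** Y ** R\<close>
  does not change when \<open>R\<close> becomes \<open>S\<close>. GNS orthogonality thus says that
  \<open>Y ** S\<close> is the tracial projection of \<open>X ** R\<close>.\<close>

lemma gns_proj_eq: "gns_proj R N X = tracial_proj N (X ** R) ** Si"
  unfolding gns_proj_def orth_proj_def gns_inner_alt
proof (rule the_equality)
  let ?Y = "tracial_proj N (X ** R) ** Si"
  have "trace (adj Z ** ?Y ** R) = trace (adj Z ** X ** R)" if "Z \<in> N" for Z
  proof -
    have "trace (adj Z ** ?Y ** R) = trace (adj Z ** ?Y ** S)"
      by (simp add: trace_mult_S closed powr_S_in that)
    also have "\<dots> = trace (adj Z ** tracial_proj N (X ** R))"
      by (simp add: matrix_mul_assoc cancel_R_S)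
    also have "\<dots> = trace (adj Z ** X ** R)"
      by (simp add: trace_tracial_proj[OF N] closed that matrix_mul_assoc)
    finally show ?thesis .
  qed
  then show "?Y \<in> N \<and> (\<forall>Z\<in>N. trace (adj Z ** X ** R) - trace (adj Z ** ?Y ** R) = 0)"
    by (simp add: closed powr_S_in)
  fix Y assume Y: "Y \<in> N \<and> (\<forall>Z\<in>N. trace (adj Z ** X ** R) - trace (adj Z ** Y ** R) = 0)"
  have "tracial_proj N (X ** R) = Y ** S"
  proof (rule tracial_proj_unique[OF N])
    fix Z assume Z: "Z \<in> N"
    have "trace (Z ** (Y ** S)) = trace (Z ** Y ** R)"
      using trace_mult_S[of "Z ** Y"] Z Y closed by (simp add: matrix_mul_assoc)
    also have "\<dots> = trace (Z ** X ** R)"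
      using bspec[OF conjunct2[OF Y], of "adj Z"] Z closed by simp
    finally show "trace (Z ** (Y ** S)) = trace (Z ** (X ** R))"
      by (simp add: matrix_mul_assoc)
  qed (simp add: Y closed)
  then show "Y = ?Y" by (simp add: cancel_R_S)
qed

text \<open>Clearing \<open>Si\<close> leaves an equation between elements of \<open>N\<close>.
  Testing it against \<open>N\<close> under the trace removes the projections and isolates
  \<open>X\<close>.\<close>

lemma self_adjoint_gns_proj_iff:
  assumes "self_adjoint X"
  shows "self_adjoint (gns_proj R N X) \<longleftrightarrow>
    (\<forall>A\<in>N. trace ((R ** A ** S - S ** A ** R) ** X) = 0)"
proof -
  have adjP: "adj (gns_proj R N X) = Si ** tracial_proj N (R ** X)"
    using assms tracial_proj_adj[OF N, of "X ** R"]
    by (simp add: gns_proj_eq adj_mult adj_mat_powr S adj_R_S self_adjoint_def)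
  have "self_adjoint (gns_proj R N X) \<longleftrightarrow>
      S ** tracial_proj N (X ** R) = tracial_proj N (R ** X) ** S" (is "_ \<longleftrightarrow> ?L = ?Rh")
  proof
    assume "self_adjoint (gns_proj R N X)"
    then have "Si ** tracial_proj N (R ** X) = tracial_proj N (X ** R) ** Si"
      by (simp add: self_adjoint_def adjP) (simp add: gns_proj_eq)
    then have "S ** (Si ** tracial_proj N (R ** X)) ** S = S ** (tracial_proj N (X ** R) ** Si) ** S"
      by simp
    then show "?L = ?Rh"
      by (simp add: matrix_mul_assoc cancel_R_S)
  next
    assume "?L = ?Rh"
    then have "Si ** ?L ** Si = Si ** ?Rh ** Si" by simp
    then show "self_adjoint (gns_proj R N X)"
      by (simp add: self_adjoint_def adjP matrix_mul_assoc cancel_R_S) (simp add: gns_proj_eq)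
  qed
  also have "\<dots> \<longleftrightarrow> (\<forall>A\<in>N. trace (A ** (?L - ?Rh)) = 0)"
    using trace_eq_0_imp[OF N, of "?L - ?Rh"] vna_diff[OF N, of ?L ?Rh] closed
    by (auto simp: matrix_mult_0_right trace_def)
  also have "\<dots> \<longleftrightarrow> (\<forall>A\<in>N. trace ((R ** A ** S - S ** A ** R) ** X) = 0)"
  proof (rule ball_cong[OF refl])
    fix A assume A: "A \<in> N"
    have "trace (A ** ?L) = trace (A ** S ** X ** R)"
      using trace_tracial_proj[OF N, of "A ** S" "X ** R"] A closed by (simp add: matrix_mul_assoc)
    also have "\<dots> = trace (R ** A ** S ** X)"
      using trace_mul_sym[of "A ** S ** X" R] by (simp add: matrix_mul_assoc)
    finally have 1: "trace (A ** ?L) = trace (R ** A ** S ** X)" .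
    have "trace (A ** ?Rh) = trace (S ** A ** tracial_proj N (R ** X))"
      using trace_mul_sym[of "A ** tracial_proj N (R ** X)" S] by (simp add: matrix_mul_assoc)
    also have "\<dots> = trace (S ** A ** R ** X)"
      using A closed by (simp add: trace_tracial_proj[OF N] matrix_mul_assoc)
    finally show "trace (A ** (?L - ?Rh)) = 0 \<longleftrightarrow> trace ((R ** A ** S - S ** A ** R) ** X) = 0"
      using 1 by (simp add: matrix_diff_ldistrib matrix_diff_rdistrib trace_sub)
  qed
  finally show ?thesis .
qed

lemma real_gns_proj_iff:
  assumes M: "von_neumann_algebra M" "N \<subseteq> M" "R \<in> M"
  shows "real_map_on M (gns_proj R N) \<longleftrightarrow> (\<forall>A\<in>N. R ** A ** S = S ** A ** R)"
proof
  assume real: "real_map_on M (gns_proj R N)"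
  show "\<forall>A\<in>N. R ** A ** S = S ** A ** R"
  proof
    fix A assume A: "A \<in> N"
    define D where "D = R ** A ** S - S ** A ** R"
    note Mc = vna_closed[OF M(1)]
    have D: "D \<in> M" "adj D \<in> M"
      using A M(2,3) closed(6)[of R] vna_diff[OF M(1)] Mc unfolding D_def by (simp_all add: subset_iff)
    have zero: "trace (D ** X) = 0" if "X \<in> M" "self_adjoint X" for X
      using real that A self_adjoint_gns_proj_iff unfolding real_map_on_def D_def by blast
    \<comment> \<open>Only self-adjoint test matrices are available; this one and
      \<open>\<i>\<close> times \<open>adj D - D\<close> together recover
      \<open>adj D\<close>.\<close>
    have "trace (D ** (adj D + D)) = 0"
      by (rule zero) (simp_all add: D Mc self_adjoint_def adj_add add.commute)
    moreover have "trace (D ** cscale \<i> (adj D - D)) = 0"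
    proof (rule zero)
      show "cscale \<i> (adj D - D) \<in> M"
        by (simp add: D Mc vna_diff[OF M(1)])
      show "self_adjoint (cscale \<i> (adj D - D))"
        by (simp add: self_adjoint_def adj_cscale adj_diff) (simp add: vec_eq_iff algebra_simps)
    qed
    ultimately have "trace (D ** adj D) = 0"
      by (simp add: matrix_add_ldistrib matrix_diff_ldistrib cscale_mult_right trace_cscale
          trace_add trace_sub)
    then have "D = 0"
      using trace_adj_mult_eq_0[of D] trace_mul_sym[of "adj D" D] by simp
    then show "R ** A ** S = S ** A ** R" by (simp add: D_def)
  qed
next
  assume "\<forall>A\<in>N. R ** A ** S = S ** A ** R"
  then have "trace ((R ** A ** S - S ** A ** R) ** X) = 0" if "A \<in> N" for A X
    using that by (simp add: trace_def matrix_matrix_mult_def)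
  then show "real_map_on M (gns_proj R N)"
    by (simp add: real_map_on_def self_adjoint_gns_proj_iff)
qed

section \<open>The Accardi-Cecchini operator\<close>

abbreviation r where "r \<equiv> mat_powr R (1/2)"
abbreviation s where "s \<equiv> mat_powr S (1/2)"
abbreviation si where "si \<equiv> mat_powr S (- (1/2))"

lemma sqrt_facts: "r ** r = R" "s ** s = S" "si ** s = mat 1" "s ** si = mat 1"
  "adj r = r" "adj s = s" "adj si = si"
  using mat_powr_cancel[OF S, of "1/2"]
  by (simp_all add: mat_powr_add mat_powr_1 adj_mat_powr R S)

lemma sqrt_mult: "A ** r ** r = A ** R" "A ** si ** S = A ** s"
proof -
  show "A ** r ** r = A ** R"
    by (simp add: sqrt_facts(1) flip: matrix_mul_assoc)
  have "si ** S = s"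
    using mat_powr_add[OF S, of "- (1/2)" 1] by (simp add: mat_powr_1 S)
  then show "A ** si ** S = A ** s"
    by (simp flip: matrix_mul_assoc)
qed

lemma accardi_cecchini_fixed_iff:
  "accardi_cecchini R N A = A \<longleftrightarrow> tracial_proj N (r ** A ** r) = s ** A ** s"
proof -
  let ?E = "tracial_proj N (r ** A ** r)"
  have "accardi_cecchini R N A = si ** ?E ** si"
    by (simp add: accardi_cecchini_def Let_def)
  moreover have "si ** ?E ** si = A \<longleftrightarrow> ?E = s ** A ** s"
  proof
    assume "si ** ?E ** si = A"
    then have "s ** (si ** ?E ** si) ** s = s ** A ** s" by simp
    then show "?E = s ** A ** s"
      by (simp add: matrix_mul_assoc sqrt_facts sqrt_facts(3)[THEN matrix_mult_cancel])
  next
    assume "?E = s ** A ** s"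
    then show "si ** ?E ** si = A"
      by (simp add: matrix_mul_assoc sqrt_facts sqrt_facts(4)[THEN matrix_mult_cancel])
  qed
  ultimately show ?thesis by simp
qed

text \<open>The squared Hilbert-Schmidt norm of the difference expands into four traces, each equal
  to \<open>trace (D ** adj D)\<close>, with signs that cancel.\<close>

lemma accardi_cecchini_imp_commute:
  assumes AC: "\<And>A. A \<in> N \<Longrightarrow> tracial_proj N (r ** A ** r) = s ** A ** s" and D: "D \<in> N"
  shows "r ** si ** D = D ** si ** r"
proof -
  let ?X = "r ** si ** D - D ** si ** r"
  note in_N = closed powr_S_in D
  note cancel = sqrt_facts(3,4) sqrt_facts(3,4)[THEN matrix_mult_cancel]
  \<comment> \<open>The fixed point property in weak form: the KMS forms of \<open>R\<close> and
    \<open>S\<close> agree on \<open>N\<close>. It gives the two mixed terms.\<close>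
  have KMS: "trace (A ** r ** B ** r) = trace (A ** s ** B ** s)" if "A \<in> N" "B \<in> N" for A B
    using trace_tracial_proj[OF N that(1), of "r ** B ** r"] AC[OF that(2)]
    by (simp add: matrix_mul_assoc)
  \<comment> \<open>Holds because \<open>S\<close> is the projection of \<open>R\<close>; it gives
    the two square terms.\<close>
  have state: "trace (si ** A ** si ** R) = trace A" if "A \<in> N" for A
  proof -
    have "trace (si ** A ** si ** R) = trace (si ** A ** s)"
      using trace_mult_S[of "si ** A ** si"] that in_N by (simp add: sqrt_mult)
    also have "\<dots> = trace (s ** si ** A)"
      using trace_mul_sym[of "si ** A" s] by (simp add: cancel matrix_mul_assoc)
    finally show ?thesis by (simp add: cancel)
  qed
  have 1: "trace (adj D ** si ** r ** r ** si ** D) = trace (D ** adj D)"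
  proof -
    have "trace (adj D ** si ** r ** r ** si ** D) = trace (si ** D ** (adj D ** si ** r ** r))"
      using trace_mul_sym[of "adj D ** si ** r ** r" "si ** D"] by (simp add: matrix_mul_assoc)
    also have "\<dots> = trace (si ** (D ** adj D) ** si ** R)"
      by (simp add: matrix_mul_assoc sqrt_mult)
    finally show ?thesis using in_N by (simp add: state)
  qed
  have 2: "trace (adj D ** si ** r ** D ** si ** r) = trace (D ** adj D)"
  proof -
    have "trace (adj D ** si ** r ** D ** si ** r) = trace (adj D ** si ** s ** (D ** si) ** s)"
      using KMS[of "adj D ** si" "D ** si"] in_N by (simp add: matrix_mul_assoc)
    also have "\<dots> = trace (adj D ** D)"
      by (simp add: matrix_mul_assoc cancel)
    finally show ?thesis using trace_mul_sym[of "adj D" D] by simp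
  qed
  have 3: "trace (r ** si ** adj D ** r ** si ** D) = trace (D ** adj D)"
  proof -
    have "trace (r ** si ** adj D ** r ** si ** D) = trace (si ** adj D ** r ** (si ** D) ** r)"
      using trace_mul_sym[of r "si ** adj D ** r ** si ** D"] by (simp add: matrix_mul_assoc)
    also have "\<dots> = trace (si ** adj D ** s ** (si ** D) ** s)"
      by (rule KMS) (simp_all add: in_N)
    also have "\<dots> = trace (s ** si ** adj D ** s ** si ** D)"
      using trace_mul_sym[of s "si ** adj D ** s ** si ** D"] by (simp add: matrix_mul_assoc)
    also have "\<dots> = trace (adj D ** D)"
      by (simp add: cancel)
    finally show ?thesis using trace_mul_sym[of "adj D" D] by simp
  qed
  have 4: "trace (r ** si ** adj D ** D ** si ** r) = trace (D ** adj D)"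
  proof -
    have "trace (r ** si ** adj D ** D ** si ** r) = trace (si ** (adj D ** D) ** si ** R)"
      using trace_mul_sym[of r "si ** adj D ** D ** si ** r"]
      by (simp add: matrix_mul_assoc sqrt_mult)
    also have "\<dots> = trace (adj D ** D)"
      using in_N by (simp add: state)
    finally show ?thesis using trace_mul_sym[of "adj D" D] by simp
  qed
  have "adj ?X = adj D ** si ** r - r ** si ** adj D"
    by (simp add: adj_diff adj_mult sqrt_facts matrix_mul_assoc)
  then have "trace (adj ?X ** ?X) = 0"
    by (simp add: matrix_diff_ldistrib matrix_diff_rdistrib matrix_mul_assoc trace_sub 1 2 3 4)
  then show ?thesis using trace_adj_mult_eq_0[of ?X] by simp
qed

lemma accardi_cecchini_iff:
  "(\<forall>A\<in>N. modular R A = modular S A) \<longleftrightarrow> (\<forall>A\<in>N. accardi_cecchini R N A = A)"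
  unfolding accardi_cecchini_fixed_iff
proof
  assume L: "\<forall>A\<in>N. modular R A = modular S A"
  show "\<forall>A\<in>N. tracial_proj N (r ** A ** r) = s ** A ** s"
  proof
    fix A assume A: "A \<in> N"
    \<comment> \<open>Multiplied by \<open>R\<close>, the half power of the modular relation
      expresses \<open>r ** A ** r\<close> as an element of \<open>N\<close> times \<open>R\<close>,
      whose projection is explicit.\<close>
    have "modular_powr R (1/2) A = modular_powr S (1/2) A"
      using modular_powr_cong[OF R S _ _ A] L modular_S_in by blast
    then have "r ** A ** mat_powr R (- (1/2)) ** R = s ** A ** si ** R"
      by (simp add: modular_powr_def)
    moreover have "mat_powr R (- (1/2)) ** R = r"
      using mat_powr_add[OF R, of "- (1/2)" 1] by (simp add: mat_powr_1 R)
    ultimately have "r ** A ** r = s ** A ** si ** R"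
      by (simp flip: matrix_mul_assoc)
    then have "tracial_proj N (r ** A ** r) = s ** A ** si ** S"
      using A by (simp add: tracial_proj_mult_left[OF N] closed powr_S_in)
    then show "tracial_proj N (r ** A ** r) = s ** A ** s"
      by (simp add: sqrt_mult)
  qed
next
  assume AC: "\<forall>A\<in>N. tracial_proj N (r ** A ** r) = s ** A ** s"
  define w where "w = r ** si"
  have comm': "w ** D = D ** si ** r" if "D \<in> N" for D
    using accardi_cecchini_imp_commute[OF _ that] AC by (simp add: w_def)
  \<comment> \<open>The case of the identity shows that \<open>w\<close> is Hermitian, which turns
    \<open>comm'\<close> into commutation with \<open>N\<close>.\<close>
  from comm'[OF closed(1)] have w: "w = si ** r" by simp
  have comm: "w ** D = D ** w" if "D \<in> N" for D
    using comm'[OF that] by (simp add: w matrix_mul_assoc)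
  have rs: "r = w ** s" "r = s ** w"
    using sqrt_facts(3,4)
    by (simp_all add: w_def matrix_mult_cancel) (simp add: w matrix_mul_assoc flip: w_def)
  have "R ** A ** S = S ** A ** R" if "A \<in> N" for A
  proof -
    \<comment> \<open>With \<open>R\<close> written as \<open>s ** w ** w ** s\<close>, this is the
      element of \<open>N\<close> that \<open>w ** w\<close> has to pass.\<close>
    let ?B = "s ** A ** s"
    have B: "?B \<in> N" using that by (simp add: closed powr_S_in)
    have R_eq: "(s ** w) ** (w ** s) = R"
      by (simp only: rs[symmetric] sqrt_facts(1))
    have ww: "w ** (w ** ?B) = ?B ** w ** w"
      by (metis comm[OF B] matrix_mul_assoc)
    have "R ** A ** S = (s ** w) ** (w ** s) ** A ** (s ** s)"
      by (simp only: R_eq sqrt_facts(2))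
    also have "\<dots> = s ** (w ** (w ** ?B)) ** s"
      by (simp only: matrix_mul_assoc)
    also have "\<dots> = (s ** s) ** A ** ((s ** w) ** (w ** s))"
      unfolding ww by (simp only: matrix_mul_assoc)
    also have "\<dots> = S ** A ** R"
      by (simp only: R_eq sqrt_facts(2))
    finally show ?thesis .
  qed
  then show "\<forall>A\<in>N. modular R A = modular S A"
    by (simp add: modular_eq_iff)
qed

end

theorem theorem4p1:
  fixes M N :: "(complex ^ 'n::finite ^ 'n) set" and \<rho> :: "complex ^ 'n ^ 'n"
  assumes "von_neumann_algebra M"
    and "von_neumann_subalgebra N M"
    and "faithful_state M \<rho>"
  shows "(real_map_on M (gns_proj \<rho> N) \<longleftrightarrow> invariant_under N (modular \<rho>)) \<and>
    (invariant_under N (modular \<rho>) \<longleftrightarrow>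
       (\<forall>A\<in>N. modular \<rho> A = modular (tracial_proj N \<rho>) A)) \<and>
    (invariant_under N (modular \<rho>) \<longrightarrow>
       (\<forall>t. \<forall>A\<in>N. modular_powr \<rho> t A = modular_powr (tracial_proj N \<rho>) t A)) \<and>
    ((\<forall>A\<in>N. modular \<rho> A = modular (tracial_proj N \<rho>) A) \<longleftrightarrow>
       (\<forall>A\<in>N. accardi_cecchini \<rho> N A = A))"
proof -
  interpret vna_posdef N \<rho>
    using assms posdef_faithful_state
    by unfold_locales (auto simp: von_neumann_subalgebra_def faithful_state_def state_def)
  have "N \<subseteq> M" "\<rho> \<in> M"
    using assms by (auto simp: von_neumann_subalgebra_def faithful_state_def state_def)
  then have "real_map_on M (gns_proj \<rho> N) \<longleftrightarrow> (\<forall>A\<in>N. modular \<rho> A = modular (tracial_proj N \<rho>) A)"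
    using real_gns_proj_iff[OF assms(1)] modular_eq_iff by simp
  moreover have "\<forall>t. \<forall>A\<in>N. modular_powr \<rho> t A = modular_powr (tracial_proj N \<rho>) t A"
    if "invariant_under N (modular \<rho>)"
    using that modular_powr_cong[OF R S] modular_S_in unfolding invariant_iff by blast
  ultimately show ?thesis
    using invariant_iff accardi_cecchini_iff by blast
qed

end
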